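(* Let $I\subset\mathbb R$ be an interval and let $\mathbf r(s)=(x(s),y(s),z(s))$, $s\in I$, be a smooth horizontally regular curve in $\mathbb H_1$ parametrized by horizontal arc length, with $p$-curvature $\kappa(s)\neq0$ for all $s$ and contact normality $\tau$. Define the radial and height functions $$R(s)=\sqrt{x(s)^2+y(s)^2},\qquad Z(s)=z(s).$$ Then $$Z'-\tau=\frac{\frac12(R^2)''-1}{\kappa},\qquad Z''-\tau'=-\frac{\kappa}{2}(R^2)' .$$ If, in addition, $\mathbf r(I)\subset\Sigma$, where $\Sigma=\{(g(v)\cos t,g(v)\sin t,f(v)): v\in J,\ 0\le t<2\pi\}$ is a rotationally symmetric surface with $J\subset\mathbb R$ an interval, $f,g:J\to\mathbb R$ smooth, $g>0$, $f'(v)^2+g'(v)^2>0$ for all $v\in J$, and $v\mapsto(g(v),0,f(v))$ an embedding, and if $v:I\to J$ is the profile parameter along $\mathbf r$ (the unique function with $x(s)^2+y(s)^2=g(v(s))^2$ and $z(s)=f(v(s))$ for all $s\in I$), then the same two identities hold with $$R(s)=g(v(s)),\qquad Z(s)=f(v(s)).$$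
   Context: The Heisenberg group $\mathbb H_1$ is identified with $\mathbb R^3$ through its standard coordinates $(x,y,z)$. A smooth curve $\mathbf r=(x,y,z)$ is horizontally regular if $(x')^2+(y')^2\neq0$ everywhere, and parametrized by horizontal arc length if $(x')^2+(y')^2\equiv1$. For such a parametrization the $p$-curvature is $\kappa=x'y''-x''y'$ and the contact normality is $\tau=xy'-x'y+z'$. Here $(R^2)'$ and $(R^2)''$ are derivatives of the smooth function $R^2=x^2+y^2$ with respect to $s$. *)

theory Defs
  imports "HOL-Analysis.Analysis"
begin

text \<open>The underlying space of the Heisenberg group in its standard coordinates \<open>(x, y, z)\<close>;
  components are written \<open>p $ 1\<close>, \<open>p $ 2\<close>, \<open>p $ 3\<close>.\<close>

type_synonym heisenberg = "real ^ 3"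

text \<open>Singletons are excluded: a derivative relative to a one-point set is not determined.\<close>

definition nondegenerate_interval :: "real set \<Rightarrow> bool" where
  "nondegenerate_interval I \<longleftrightarrow> is_interval I \<and> interior I \<noteq> {}"

text \<open>The derivative relative to \<open>I\<close>: one-sided at an endpoint belonging to \<open>I\<close>. It depends
  only on the values of \<open>h\<close> on \<open>I\<close>. The interval need not be open, so \<open>deriv\<close> does not suffice.\<close>

definition deriv_on :: "real set \<Rightarrow> (real \<Rightarrow> 'a::real_normed_vector) \<Rightarrow> real \<Rightarrow> 'a" where
  "deriv_on I h s = vector_derivative h (at s within I)"

definition smooth_on :: "real set \<Rightarrow> (real \<Rightarrow> 'a::real_normed_vector) \<Rightarrow> bool" where
  "smooth_on I h \<longleftrightarrow> (\<forall>n. (deriv_on I ^^ n) h differentiable_on I)"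

definition horizontally_regular :: "real set \<Rightarrow> (real \<Rightarrow> heisenberg) \<Rightarrow> bool" where
  "horizontally_regular I r \<longleftrightarrow>
    (\<forall>s\<in>I. (deriv_on I (\<lambda>u. r u $ 1) s)\<^sup>2 + (deriv_on I (\<lambda>u. r u $ 2) s)\<^sup>2 \<noteq> 0)"

definition horizontal_arc_length :: "real set \<Rightarrow> (real \<Rightarrow> heisenberg) \<Rightarrow> bool" where
  "horizontal_arc_length I r \<longleftrightarrow>
    (\<forall>s\<in>I. (deriv_on I (\<lambda>u. r u $ 1) s)\<^sup>2 + (deriv_on I (\<lambda>u. r u $ 2) s)\<^sup>2 = 1)"

text \<open>The \<open>p\<close>-curvature \<open>x' y'' - x'' y'\<close> and the contact normality \<open>x y' - x' y + z'\<close>; both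
  formulas presuppose parametrization by horizontal arc length.\<close>

definition p_curvature :: "real set \<Rightarrow> (real \<Rightarrow> heisenberg) \<Rightarrow> real \<Rightarrow> real" where
  "p_curvature I r s =
    (let x = (\<lambda>u. r u $ 1); y = (\<lambda>u. r u $ 2)
     in deriv_on I x s * deriv_on I (deriv_on I y) s
        - deriv_on I (deriv_on I x) s * deriv_on I y s)"

definition contact_normality :: "real set \<Rightarrow> (real \<Rightarrow> heisenberg) \<Rightarrow> real \<Rightarrow> real" where
  "contact_normality I r s =
    (let x = (\<lambda>u. r u $ 1); y = (\<lambda>u. r u $ 2); z = (\<lambda>u. r u $ 3)
     in x s * deriv_on I y s - deriv_on I x s * y s + deriv_on I z s)"

definition radial_height_identities ::
    "real set \<Rightarrow> (real \<Rightarrow> heisenberg) \<Rightarrow> (real \<Rightarrow> real) \<Rightarrow> (real \<Rightarrow> real) \<Rightarrow> bool" where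
  "radial_height_identities I r R Z \<longleftrightarrow>
    (let R2 = (\<lambda>u. (R u)\<^sup>2); \<kappa> = p_curvature I r; \<tau> = contact_normality I r
     in \<forall>s\<in>I.
       deriv_on I Z s - \<tau> s = (1 / 2 * deriv_on I (deriv_on I R2) s - 1) / \<kappa> s \<and>
       deriv_on I (deriv_on I Z) s - deriv_on I \<tau> s = - (\<kappa> s / 2) * deriv_on I R2 s)"

definition rotation_surface ::
    "real set \<Rightarrow> (real \<Rightarrow> real) \<Rightarrow> (real \<Rightarrow> real) \<Rightarrow> heisenberg set" where
  "rotation_surface J f g =
    {vector [g v * cos t, g v * sin t, f v] | v t. v \<in> J \<and> 0 \<le> t \<and> t < 2 * pi}"

text \<open>The immersion part of the embedding condition on \<open>v \<mapsto> (g v, 0, f v)\<close> is the condition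
  \<open>f'\<^sup>2 + g'\<^sup>2 > 0\<close>; the topological part is \<open>embedding_map\<close>.\<close>

definition admissible_profile :: "real set \<Rightarrow> (real \<Rightarrow> real) \<Rightarrow> (real \<Rightarrow> real) \<Rightarrow> bool" where
  "admissible_profile J f g \<longleftrightarrow>
    nondegenerate_interval J \<and> smooth_on J f \<and> smooth_on J g \<and>
    (\<forall>v\<in>J. g v > 0) \<and>
    (\<forall>v\<in>J. (deriv_on J f v)\<^sup>2 + (deriv_on J g v)\<^sup>2 > 0) \<and>
    embedding_map (top_of_set J) euclidean (\<lambda>v. vector [g v, 0, f v] :: heisenberg)"

definition has_profile_parameter ::
    "(real \<Rightarrow> real) \<Rightarrow> (real \<Rightarrow> real) \<Rightarrow> heisenberg \<Rightarrow> real \<Rightarrow> bool" where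
  "has_profile_parameter f g p v \<longleftrightarrow> (p $ 1)\<^sup>2 + (p $ 2)\<^sup>2 = (g v)\<^sup>2 \<and> p $ 3 = f v"

end

theory Submission
  imports Defs
begin

text \<open>Differentiating \<open>x'\<^sup>2 + y'\<^sup>2 = 1\<close> gives \<open>x' x'' + y' y'' = 0\<close>, hence the Frenet equations
  \<open>x'' = -\<kappa> y'\<close> and \<open>y'' = \<kappa> x'\<close>. Substituting them into \<open>(R\<^sup>2)'' / 2 = 1 + x x'' + y y''\<close> and into
  the derivative of \<open>Z' - \<tau> = x' y - x y'\<close> gives both identities. They involve \<open>R\<close> only through
  \<open>R\<^sup>2\<close>, and only through values on \<open>I\<close>, so any \<open>R, Z\<close> with \<open>R\<^sup>2 = x\<^sup>2 + y\<^sup>2\<close> and \<open>Z = z\<close> there will do.\<close>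

text \<open>Both functions admit the same derivatives relative to \<open>I\<close>, so the choice in
  \<open>vector_derivative\<close> returns the same value even where no derivative exists.\<close>

lemma deriv_on_cong:
  assumes "\<And>u. u \<in> I \<Longrightarrow> h u = k u" and "s \<in> I"
  shows "deriv_on I h s = deriv_on I k s"
proof -
  have "(h has_vector_derivative d) (at s within I) \<longleftrightarrow> (k has_vector_derivative d) (at s within I)" for d
    using assms has_vector_derivative_transform[of s I h k d]
      has_vector_derivative_transform[of s I k h d] by auto
  then show ?thesis
    unfolding deriv_on_def vector_derivative_def by simp
qed

text \<open>An infinite connected set has no isolated points. This makes derivatives relative to
  \<open>I\<close> unique, including at endpoints belonging to \<open>I\<close>.\<close>

lemma nondegenerate_interval_at_within_neq_bot:
  assumes "nondegenerate_interval I" and "s \<in> I"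
  shows "at s within I \<noteq> bot"
proof -
  have "infinite I"
    using assms empty_interior_finite unfolding nondegenerate_interval_def by blast
  then have "s islimpt I"
    using assms connected_imp_perfect[of I s] is_interval_connected
    unfolding nondegenerate_interval_def by (metis finite.simps)
  then show ?thesis
    by (simp add: trivial_limit_within)
qed

lemma deriv_on_eqI:
  assumes "nondegenerate_interval I" and "s \<in> I"
    and "(h has_vector_derivative d) (at s within I)"
  shows "deriv_on I h s = d"
  using assms vector_derivative_within[OF nondegenerate_interval_at_within_neq_bot]
  unfolding deriv_on_def by blast

lemma smooth_on_has_vector_derivative:
  assumes "smooth_on I h" and "s \<in> I"
  shows "((deriv_on I ^^ n) h has_vector_derivative (deriv_on I ^^ Suc n) h s) (at s within I)"
proof -
  have "(deriv_on I ^^ n) h differentiable (at s within I)"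
    using assms unfolding smooth_on_def differentiable_on_def by blast
  then show ?thesis
    by (simp add: vector_derivative_works deriv_on_def)
qed

lemma has_vector_derivative_vec_nth:
  assumes "(h has_vector_derivative d) F"
  shows "((\<lambda>u. h u $ i) has_real_derivative d $ i) F"
  using bounded_linear.has_vector_derivative[OF bounded_linear_vec_nth assms]
  by (simp add: has_real_derivative_iff_has_vector_derivative)

lemma radial_height_identitiesI:
  fixes r :: "real \<Rightarrow> heisenberg"
  assumes I: "nondegenerate_interval I"
    and smooth: "smooth_on I r"
    and unit: "horizontal_arc_length I r"
    and \<kappa>: "\<forall>s\<in>I. p_curvature I r s \<noteq> 0"
    and R: "\<And>s. s \<in> I \<Longrightarrow> (R s)\<^sup>2 = (r s $ 1)\<^sup>2 + (r s $ 2)\<^sup>2"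
    and Z: "\<And>s. s \<in> I \<Longrightarrow> Z s = r s $ 3"
  shows "radial_height_identities I r R Z"
proof -
  define r1 where "r1 = deriv_on I r"
  define r2 where "r2 = deriv_on I r1"
  have d0: "((\<lambda>u. r u $ i) has_real_derivative r1 s $ i) (at s within I)" if "s \<in> I" for s i
    using smooth_on_has_vector_derivative[OF smooth that, of 0]
    by (simp add: has_vector_derivative_vec_nth r1_def)
  have d1: "((\<lambda>u. r1 u $ i) has_real_derivative r2 s $ i) (at s within I)" if "s \<in> I" for s i
    using smooth_on_has_vector_derivative[OF smooth that, of 1]
    by (simp add: has_vector_derivative_vec_nth r1_def r2_def)
  \<comment> \<open>Closed forms for first derivatives hold only on \<open>I\<close>. To
    differentiate again, \<open>h\<close> is replaced by a formula \<open>k\<close> that agrees with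
    it there.\<close>
  have eqI: "deriv_on I h s = d"
    if "s \<in> I" "(k has_real_derivative d) (at s within I)" "\<And>u. u \<in> I \<Longrightarrow> h u = k u" for h k d s
    using deriv_on_eqI[OF I that(1), of k d] deriv_on_cong[OF that(3) that(1)] that(2)
    by (simp add: has_real_derivative_iff_has_vector_derivative)
  have D1: "deriv_on I (\<lambda>u. r u $ i) s = r1 s $ i" if "s \<in> I" for s i
    by (rule eqI[OF that d0[OF that]]) simp
  have D2: "deriv_on I (deriv_on I (\<lambda>u. r u $ i)) s = r2 s $ i" if "s \<in> I" for s i
    by (rule eqI[OF that d1[OF that]]) (rule D1)
  have DZ: "deriv_on I Z s = r1 s $ 3" if "s \<in> I" for s
    by (rule eqI[OF that d0[OF that]]) (rule Z)
  have DDZ: "deriv_on I (deriv_on I Z) s = r2 s $ 3" if "s \<in> I" for s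
    by (rule eqI[OF that d1[OF that]]) (rule DZ)
  have unit': "(r1 s $ 1)\<^sup>2 + (r1 s $ 2)\<^sup>2 = 1" if "s \<in> I" for s
    using unit that by (simp add: horizontal_arc_length_def D1)
  have orth: "r1 s $ 1 * r2 s $ 1 + r1 s $ 2 * r2 s $ 2 = 0" if "s \<in> I" for s
  proof -
    \<comment> \<open>The squared horizontal speed is differentiated twice over: by the product
      rule, and as the constant 1.\<close>
    have "deriv_on I (\<lambda>u. (r1 u $ 1)\<^sup>2 + (r1 u $ 2)\<^sup>2) s
        = 2 * (r1 s $ 1 * r2 s $ 1 + r1 s $ 2 * r2 s $ 2)"
      by (rule eqI[OF that]) (auto intro!: derivative_eq_intros d1 that)
    moreover have "deriv_on I (\<lambda>u. (r1 u $ 1)\<^sup>2 + (r1 u $ 2)\<^sup>2) s = 0"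
      by (rule eqI[OF that, of "\<lambda>_. 1"]) (auto simp: unit')
    ultimately show ?thesis by simp
  qed
  have \<kappa>_eq: "p_curvature I r s = r1 s $ 1 * r2 s $ 2 - r2 s $ 1 * r1 s $ 2" if "s \<in> I" for s
    using that by (simp add: p_curvature_def Let_def D1 D2)
  have frenet: "r2 s $ 1 = - p_curvature I r s * r1 s $ 2" "r2 s $ 2 = p_curvature I r s * r1 s $ 1"
    if "s \<in> I" for s
  proof -
    \<comment> \<open>Expand (x'', y'') in the orthonormal frame (x', y'), (-y', x'): the tangential
      coefficient is 0 by \<open>orth\<close>, the normal one is \<kappa>.\<close>
    have "r2 s $ 1 * ((r1 s $ 1)\<^sup>2 + (r1 s $ 2)\<^sup>2) =
        - p_curvature I r s * r1 s $ 2 + r1 s $ 1 * (r1 s $ 1 * r2 s $ 1 + r1 s $ 2 * r2 s $ 2)"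
      unfolding \<kappa>_eq[OF that] by (simp add: algebra_simps power2_eq_square)
    then show "r2 s $ 1 = - p_curvature I r s * r1 s $ 2"
      unfolding unit'[OF that] orth[OF that] by simp
    have "r2 s $ 2 * ((r1 s $ 1)\<^sup>2 + (r1 s $ 2)\<^sup>2) =
        p_curvature I r s * r1 s $ 1 + r1 s $ 2 * (r1 s $ 1 * r2 s $ 1 + r1 s $ 2 * r2 s $ 2)"
      unfolding \<kappa>_eq[OF that] by (simp add: algebra_simps power2_eq_square)
    then show "r2 s $ 2 = p_curvature I r s * r1 s $ 1"
      unfolding unit'[OF that] orth[OF that] by simp
  qed
  have \<tau>_eq: "contact_normality I r s = r s $ 1 * r1 s $ 2 - r1 s $ 1 * r s $ 2 + r1 s $ 3"
    if "s \<in> I" for s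
    using that by (simp add: contact_normality_def Let_def D1)
  \<comment> \<open>The two x' y' terms of the product rule cancel.\<close>
  have D\<tau>: "deriv_on I (contact_normality I r) s
      = r s $ 1 * r2 s $ 2 - r2 s $ 1 * r s $ 2 + r2 s $ 3" if "s \<in> I" for s
    by (rule eqI[OF that _ \<tau>_eq])
       (auto intro!: derivative_eq_intros d0 d1 that simp: algebra_simps)
  have DR: "deriv_on I (\<lambda>u. (R u)\<^sup>2) s = 2 * (r s $ 1 * r1 s $ 1 + r s $ 2 * r1 s $ 2)"
    if "s \<in> I" for s
    by (rule eqI[OF that _ R]) (auto intro!: derivative_eq_intros d0 that simp: algebra_simps)
  have DDR: "deriv_on I (deriv_on I (\<lambda>u. (R u)\<^sup>2)) s
      = 2 * ((r1 s $ 1)\<^sup>2 + (r1 s $ 2)\<^sup>2 + r s $ 1 * r2 s $ 1 + r s $ 2 * r2 s $ 2)"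
    if "s \<in> I" for s
    by (rule eqI[OF that _ DR])
       (auto intro!: derivative_eq_intros d0 d1 that simp: algebra_simps power2_eq_square)
  show ?thesis
    unfolding radial_height_identities_def Let_def
  proof (intro ballI conjI)
    fix s assume s: "s \<in> I"
    \<comment> \<open>Unit speed removes the 1, and the Frenet equations turn x x'' + y y'' into
      \<kappa> (x' y - x y').\<close>
    have "1 / 2 * deriv_on I (deriv_on I (\<lambda>u. (R u)\<^sup>2)) s - 1
        = p_curvature I r s * (deriv_on I Z s - contact_normality I r s)"
      by (simp add: DDR DZ \<tau>_eq s unit' frenet algebra_simps)
    with \<kappa> s show "deriv_on I Z s - contact_normality I r s
        = (1 / 2 * deriv_on I (deriv_on I (\<lambda>u. (R u)\<^sup>2)) s - 1) / p_curvature I r s"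
      by simp
    \<comment> \<open>Here Z'' - \<tau>' = x'' y - x y'', which the Frenet equations turn into
      -\<kappa> (x x' + y y').\<close>
    show "deriv_on I (deriv_on I Z) s - deriv_on I (contact_normality I r) s
        = - (p_curvature I r s / 2) * deriv_on I (\<lambda>u. (R u)\<^sup>2) s"
      by (simp add: DDZ D\<tau> DR s frenet algebra_simps)
  qed
qed

text \<open>Existence forgets the rotation angle. For uniqueness, positivity of \<open>g\<close>
  recovers \<open>g v\<close> from its square, and the embedded profile curve is injective on
  \<open>J\<close>.\<close>

lemma ex1_profile_parameter:
  assumes adm: "admissible_profile J f g" and p: "p \<in> rotation_surface J f g"
  shows "\<exists>!w. w \<in> J \<and> has_profile_parameter f g p w"
proof (rule ex_ex1I)
  obtain v t where "v \<in> J" "p = vector [g v * cos t, g v * sin t, f v]"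
    using p unfolding rotation_surface_def by blast
  moreover have "(g v * cos t)\<^sup>2 + (g v * sin t)\<^sup>2 = (g v)\<^sup>2"
    unfolding power_mult_distrib distrib_left[symmetric] by simp
  ultimately show "\<exists>w. w \<in> J \<and> has_profile_parameter f g p w"
    by (auto simp: has_profile_parameter_def)
next
  fix v w
  assume v: "v \<in> J \<and> has_profile_parameter f g p v"
    and w: "w \<in> J \<and> has_profile_parameter f g p w"
  have pos: "\<forall>v\<in>J. g v > 0" and
    emb: "embedding_map (top_of_set J) euclidean (\<lambda>v. vector [g v, 0, f v] :: heisenberg)"
    using adm unfolding admissible_profile_def by auto
  have "f v = f w" "(g v)\<^sup>2 = (g w)\<^sup>2"
    using v w by (auto simp: has_profile_parameter_def)
  then have "f v = f w" "g v = g w"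
    using pos v w by (auto simp: power2_eq_iff_nonneg less_imp_le)
  moreover have "inj_on (\<lambda>v. vector [g v, 0, f v] :: heisenberg) J"
    using homeomorphic_imp_injective_map[OF emb[unfolded embedding_map_def]] by simp
  ultimately show "v = w"
    using v w by (simp add: inj_onD)
qed

theorem corollary3p3:
  fixes I :: "real set" and r :: "real \<Rightarrow> heisenberg"
  assumes "nondegenerate_interval I"
    and "smooth_on I r"
    and "horizontally_regular I r"
    and "horizontal_arc_length I r"
    and "\<forall>s\<in>I. p_curvature I r s \<noteq> 0"
  shows "radial_height_identities I r
           (\<lambda>s. sqrt ((r s $ 1)\<^sup>2 + (r s $ 2)\<^sup>2)) (\<lambda>s. r s $ 3) \<and>
         (\<forall>J f g. admissible_profile J f g \<and> r ` I \<subseteq> rotation_surface J f g \<longrightarrow>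
           (\<forall>s\<in>I. \<exists>!w. w \<in> J \<and> has_profile_parameter f g (r s) w) \<and>
           (\<forall>v. (\<forall>s\<in>I. v s \<in> J \<and> has_profile_parameter f g (r s) (v s)) \<longrightarrow>
             radial_height_identities I r (\<lambda>s. g (v s)) (\<lambda>s. f (v s))))"
proof (intro conjI allI impI)
  show "radial_height_identities I r
          (\<lambda>s. sqrt ((r s $ 1)\<^sup>2 + (r s $ 2)\<^sup>2)) (\<lambda>s. r s $ 3)"
    by (rule radial_height_identitiesI) (use assms in auto)
next
  fix J f g
  assume "admissible_profile J f g \<and> r ` I \<subseteq> rotation_surface J f g"
  then show "\<forall>s\<in>I. \<exists>!w. w \<in> J \<and> has_profile_parameter f g (r s) w"
    by (intro ballI ex1_profile_parameter) auto
next
  fix J f g and v :: "real \<Rightarrow> real"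
  assume v: "\<forall>s\<in>I. v s \<in> J \<and> has_profile_parameter f g (r s) (v s)"
  show "radial_height_identities I r (\<lambda>s. g (v s)) (\<lambda>s. f (v s))"
  \<comment> \<open>The relations defining the profile parameter are exactly what the lemma asks of
    \<open>R\<close> and \<open>Z\<close>.\<close>
  proof (rule radial_height_identitiesI)
    show "(g (v s))\<^sup>2 = (r s $ 1)\<^sup>2 + (r s $ 2)\<^sup>2" "f (v s) = r s $ 3" if "s \<in> I" for s
      using bspec[OF v that] by (simp_all add: has_profile_parameter_def)
  qed (use assms in blast)+
qed

end
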